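(* Let $p$ be a prime, $n,m\ge 1$ integers, $F:\mathbb{F}_{p^n}\to\mathbb{F}_{p^m}$ any function, and fix $u\in\mathbb{F}_{p^n}$. The following are equivalent: (i) $D_uF$ is balanced; (ii) $L_F(u,v;j)=0$ for every $v\in\mathbb{F}_{p^m}^*$ and every $j\in\mathbb{F}_p$; (iii) $\mathrm{AC}_F(u,w)=0$ for every $w\in\mathbb{F}_{p^m}^*$.
   Context: $\zeta_p=e^{2\pi i/p}$; $\mathrm{Tr}_1^m$ is the absolute trace $\mathbb{F}_{p^m}\to\mathbb{F}_p$; $\mathbb{F}_{p^m}^*=\mathbb{F}_{p^m}\setminus\{0\}$. The derivative is $D_uF(x)=F(x+u)-F(x)$; it is balanced if every value in $\mathbb{F}_{p^m}$ has exactly $p^{n-m}$ preimages. The additive autocorrelation is $\mathrm{AC}_F(u,v)=\sum_{x\in\mathbb{F}_{p^n}}\zeta_p^{\mathrm{Tr}_1^m(vD_uF(x))}$. The centered level count is $L_F(u,v;j)=\#\{x\in\mathbb{F}_{p^n}:\mathrm{Tr}_1^m(vD_uF(x))=j\}-p^{n-1}$. *)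

theory Defs
  imports Complex_Main "HOL-Library.Cardinality" "HOL-Computational_Algebra.Primes"
begin

text \<open>
  The field with \<open>q\<close> elements is any type of class \<open>field\<close> and \<open>finite\<close> whose cardinality
  is \<open>q\<close>.  The field with \<open>p\<close> elements is taken to be the prime subfield of the field at hand,
  so that traces are elements of that field.
\<close>

definition prime_subfield :: "nat \<Rightarrow> 'b::field set" where
  "prime_subfield p = of_nat ` {..<p}"

definition abs_trace :: "nat \<Rightarrow> nat \<Rightarrow> 'b::field \<Rightarrow> 'b" where
  "abs_trace p m x = (\<Sum>i<m. x ^ (p ^ i))"

definition zeta :: "nat \<Rightarrow> complex" where
  "zeta p = exp (2 * of_real pi * \<i> / of_nat p)"

text \<open>
  Powers of \<open>zeta p\<close> with exponent \<open>a\<close> in the prime subfield: the exponent is read as the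
  representative of \<open>a\<close> in \<open>{0, ..., p - 1}\<close>.  Only meaningful in characteristic \<open>p\<close> and for
  \<open>a \<in> prime_subfield p\<close>.
\<close>

definition residue_rep :: "nat \<Rightarrow> 'b::field \<Rightarrow> nat" where
  "residue_rep p a = (THE k. k < p \<and> of_nat k = a)"

definition zeta_pow :: "nat \<Rightarrow> 'b::field \<Rightarrow> complex" where
  "zeta_pow p a = zeta p ^ residue_rep p a"

definition derivative :: "('a::field \<Rightarrow> 'b::field) \<Rightarrow> 'a \<Rightarrow> 'a \<Rightarrow> 'b" where
  "derivative F u x = F (x + u) - F x"

text \<open>
  The exponent \<open>n - m\<close> is an integer, so for \<open>n < m\<close> the required number of preimages is a
  proper fraction and no map is balanced.
\<close>

definition balanced :: "nat \<Rightarrow> nat \<Rightarrow> nat \<Rightarrow> ('a::{field,finite} \<Rightarrow> 'b::{field,finite}) \<Rightarrow> bool" where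
  "balanced p n m G \<longleftrightarrow>
     (\<forall>y. real (card {x. G x = y}) = real p powi (int n - int m))"

definition AC ::
  "nat \<Rightarrow> nat \<Rightarrow> ('a::{field,finite} \<Rightarrow> 'b::{field,finite}) \<Rightarrow> 'a \<Rightarrow> 'b \<Rightarrow> complex" where
  "AC p m F u v = (\<Sum>x\<in>UNIV. zeta_pow p (abs_trace p m (v * derivative F u x)))"

definition level_count ::
  "nat \<Rightarrow> nat \<Rightarrow> nat \<Rightarrow> ('a::{field,finite} \<Rightarrow> 'b::{field,finite}) \<Rightarrow> 'a \<Rightarrow> 'b \<Rightarrow> 'b \<Rightarrow> int" where
  "level_count p n m F u v j =
     int (card {x. abs_trace p m (v * derivative F u x) = j}) - int p ^ (n - 1)"

end

theory Submission
  imports Defs "HOL-Number_Theory.Cong" "HOL-Computational_Algebra.Polynomial"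
begin

text \<open>
  Write \<open>G\<close> for the derivative and \<open>\<chi> y = zeta_pow p (Tr y)\<close>.  The trace is additive, takes
  values in the prime subfield and is not identically zero (it is a polynomial of degree less than
  the number of field elements), so all its fibres over the prime subfield have the same size; hence
  (i) gives (ii).  Grouping the autocorrelation sum by trace values turns it under (ii) into a
  multiple of the vanishing sum of all \<open>p\<close>-th roots of unity, which is (iii).  Finally, the number
  of preimages of \<open>y\<close> under \<open>G\<close> is recovered from the autocorrelations by Fourier inversion,
  \<open>p ^ m * card {x. G x = y} = (\<Sum>x. \<Sum>w. \<chi> (w * (G x - y)))\<close>, and under (iii) only \<open>w = 0\<close>
  contributes after exchanging the sums, so that (i) follows.
\<close>

section \<open>General facts on finite fields\<close>

lemma finite_field_power_card:
  fixes x :: "'b::{field,finite}"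
  shows "x ^ CARD('b) = x"
proof (cases "x = 0")
  case False
  \<comment> \<open>Multiplication by nonzero \<open>x\<close> permutes the nonzero elements;
    cancelling their nonzero product leaves \<open>x ^ (CARD('b) - 1) = 1\<close>.\<close>
  have "(\<Prod>y\<in>UNIV-{0}. y) = (\<Prod>y\<in>UNIV-{0}. x * y)"
    by (rule prod.reindex_bij_witness[of _ "\<lambda>y. x * y" "\<lambda>y. y / x"]) (use False in auto)
  also have "\<dots> = x ^ (CARD('b) - 1) * (\<Prod>y\<in>UNIV-{0}. y)"
    by (simp add: prod.distrib card_Diff_singleton)
  finally have "x ^ (CARD('b) - 1) = 1"
    by simp
  moreover have "CARD('b) = Suc (CARD('b) - 1)"
    by simp
  ultimately show ?thesis
    by (metis mult.right_neutral power_Suc)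
qed (simp add: power_0_left)

text \<open>Translation by 1 permutes the field, so the sum of all elements is unchanged when each
  of them grows by 1.\<close>

lemma of_nat_CARD_eq_0: "of_nat CARD('b) = (0 :: 'b::{field,finite})"
proof -
  have "(\<Sum>x\<in>(UNIV::'b set). x) = (\<Sum>x\<in>UNIV. x + 1)"
    by (rule sum.reindex_bij_witness[of _ "\<lambda>x. x + 1" "\<lambda>x. x - 1"]) auto
  then show ?thesis
    by (simp add: sum.distrib)
qed

section \<open>Powers of the root of unity \<open>zeta p\<close>\<close>

lemma zeta_power_eq_1: "p > 0 \<Longrightarrow> zeta p ^ p = 1"
  by (simp add: zeta_def flip: exp_of_nat_mult)

lemma zeta_neq_1:
  assumes "p > 1"
  shows "zeta p \<noteq> 1"
proof
  assume "zeta p = 1"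
  moreover have "zeta p = cis (2 * pi / real p)"
    by (simp add: zeta_def cis_conv_exp mult_ac)
  \<comment> \<open>The real part gives \<open>cos (2 * pi / p) = 1\<close>, so the angle is an
    integer multiple of \<open>2 * pi\<close>; this would make \<open>p\<close> a divisor of
    1.\<close>
  ultimately obtain k :: int where "2 * pi / real p = 2 * pi * of_int k"
    by (auto simp: complex_eq_iff cos_one_2pi_int)
  then have "of_int (k * int p) = (of_int 1 :: real)"
    using assms by (simp add: field_simps)
  then have "k * int p = 1"
    by (simp only: of_int_eq_iff)
  then show False
    using assms by (auto simp: zmult_eq_1_iff)
qed

lemma zeta_power_mod:
  assumes "p > 0"
  shows "zeta p ^ (k mod p) = zeta p ^ k"
proof -
  have "zeta p ^ k = zeta p ^ (p * (k div p) + k mod p)"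
    by simp
  also have "\<dots> = zeta p ^ (k mod p)"
    using zeta_power_eq_1[OF assms] by (simp only: power_add power_mult power_one mult_1)
  finally show ?thesis ..
qed

section \<open>Characteristic, Frobenius and the prime subfield\<close>

locale finite_field_of_order =
  fixes p m :: nat and field_type :: "'b::{field,finite} itself"
  assumes prime_p: "prime p" and card_field: "CARD('b) = p ^ m"
begin

lemma p_gt_0: "p > 0" and p_gt_1: "p > 1"
  using prime_p prime_gt_0_nat prime_gt_1_nat by blast+

lemma m_gt_0: "m > 0"
proof (rule ccontr)
  assume "\<not> m > 0"
  then have "card {0, 1::'b} \<le> 1"
    using card_mono[of UNIV "{0, 1::'b}"] card_field by simp
  then show False
    by simp
qed

text \<open>The characteristic is a prime that divides the field order \<open>p ^ m\<close>.\<close>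

lemma char_eq: "CHAR('b) = p"
proof -
  have "prime CHAR('b)"
    by (rule prime_CHAR_semidom) (simp add: finite_imp_CHAR_pos)
  moreover have "CHAR('b) dvd p ^ m"
    using of_nat_CARD_eq_0[where 'b='b] by (simp only: of_nat_eq_0_iff_char_dvd card_field)
  ultimately show ?thesis
    using prime_p by (metis prime_dvd_power primes_dvd_imp_eq)
qed

lemma of_nat_eq_iff_mod: "of_nat a = (of_nat b :: 'b) \<longleftrightarrow> a mod p = b mod p"
  by (simp add: of_nat_eq_iff_cong_CHAR char_eq cong_def)

lemma inj_on_of_nat: "inj_on (of_nat :: nat \<Rightarrow> 'b) {..<p}"
  by (auto simp: inj_on_def of_nat_eq_iff_mod)

lemma of_nat_in_prime_subfield: "(of_nat k :: 'b) \<in> prime_subfield p"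
  unfolding prime_subfield_def
  by (rule image_eqI[of _ _ "k mod p"]) (use p_gt_0 in \<open>auto simp: of_nat_eq_iff_mod\<close>)

lemma card_prime_subfield: "card (prime_subfield p :: 'b set) = p"
  unfolding prime_subfield_def by (simp add: card_image inj_on_of_nat)

lemma frobenius_add: "(x + y :: 'b) ^ (p ^ i) = x ^ (p ^ i) + y ^ (p ^ i)"
  by (rule freshmans_dream') (simp_all add: char_eq prime_p)

lemma of_nat_frobenius: "(of_nat k :: 'b) ^ (p ^ i) = of_nat k"
  by (induction k) (use p_gt_0 in \<open>simp_all add: frobenius_add power_0_left\<close>)

text \<open>The \<open>p\<close> elements of the prime subfield are roots of X^p - X, and a nonzero
  polynomial of degree \<open>p\<close> has no further ones.\<close>

lemma prime_subfield_eq: "prime_subfield p = {a::'b. a ^ p = a}"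
proof (rule card_seteq)
  show "prime_subfield p \<subseteq> {a::'b. a ^ p = a}"
    using of_nat_frobenius[of _ 1] by (auto simp: prime_subfield_def)
  let ?P = "monom 1 p - monom 1 1 :: 'b poly"
  have "degree ?P = p"
    using p_gt_1 degree_add_eq_left[of "- monom 1 1" "monom 1 p :: 'b poly"]
    by (simp add: degree_monom_eq)
  moreover from this have "?P \<noteq> 0"
    using p_gt_0 by auto
  ultimately have "card {a. poly ?P a = 0} \<le> p"
    using card_poly_roots_bound[of ?P] by simp
  then show "card {a::'b. a ^ p = a} \<le> card (prime_subfield p :: 'b set)"
    by (simp add: card_prime_subfield poly_monom)
qed simp

section \<open>The absolute trace and its fibres\<close>

lemma trace_add: "abs_trace p m (x + y :: 'b) = abs_trace p m x + abs_trace p m y"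
  by (simp add: abs_trace_def frobenius_add sum.distrib)

lemma trace_of_nat_mult: "abs_trace p m (of_nat k * x :: 'b) = of_nat k * abs_trace p m x"
  by (simp add: abs_trace_def power_mult_distrib of_nat_frobenius sum_distrib_left)

text \<open>Frobenius sends each term x^(p^i) to the next one, and the last to x^(p^m) = x. The
  trace is thus fixed by Frobenius.\<close>

lemma trace_in_prime_subfield: "abs_trace p m (x::'b) \<in> prime_subfield p"
proof -
  have "abs_trace p m x ^ p = (\<Sum>i<m. (x ^ p ^ i) ^ p)"
    unfolding abs_trace_def by (rule freshmans_dream_sum) (simp_all add: char_eq prime_p)
  also have "\<dots> = (\<Sum>i<m. x ^ p ^ Suc i)"
    by (simp add: mult.commute flip: power_mult)
  also have "\<dots> = (\<Sum>i<Suc m. x ^ p ^ i) - x"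
    by (subst sum.lessThan_Suc_shift) simp
  also have "\<dots> = abs_trace p m x"
    using finite_field_power_card[of x] by (simp add: abs_trace_def card_field)
  finally show ?thesis
    by (simp add: prime_subfield_eq)
qed

lemma trace_nonzero: "\<exists>z::'b. abs_trace p m z \<noteq> 0"
proof (rule ccontr)
  assume "\<nexists>z::'b. abs_trace p m z \<noteq> 0"
  define P :: "'b poly" where "P = (\<Sum>i<m. monom 1 (p ^ i))"
  have "poly P z = 0" for z
    using \<open>\<nexists>z::'b. abs_trace p m z \<noteq> 0\<close> by (simp add: P_def poly_sum poly_monom abs_trace_def)
  moreover have "degree P < p ^ m"
    unfolding P_def using p_gt_1 by (intro degree_sum_less) (auto simp: degree_monom_eq)
  \<comment> \<open>Among the exponents \<open>p ^ i\<close> only \<open>i = 0\<close> gives 1. So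
    \<open>P\<close> is nonzero, yet all \<open>p ^ m\<close> field elements would be roots of it,
    exceeding its degree.\<close>
  moreover have "coeff P 1 = 1"
  proof -
    have "coeff P 1 = (\<Sum>i<m. if i = 0 then 1 else 0)"
      unfolding P_def coeff_sum using p_gt_1 by (intro sum.cong) auto
    then show ?thesis
      using m_gt_0 by simp
  qed
  moreover from this have "P \<noteq> 0"
    by force
  ultimately show False
    using card_poly_roots_bound[of P] by (auto simp: card_field)
qed

lemma trace_surj:
  assumes "j \<in> prime_subfield p"
  shows "\<exists>z::'b. abs_trace p m z = j"
proof -
  obtain z :: 'b where z: "abs_trace p m z \<noteq> 0"
    using trace_nonzero by blast
  define c where "c = j / abs_trace p m z"
  \<comment> \<open>A quotient of two elements fixed by Frobenius is fixed, so \<open>c\<close> is a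
    scalar from the prime subfield and can be pulled out of the trace.\<close>
  have "c ^ p = c"
    using assms trace_in_prime_subfield[of z] by (simp add: prime_subfield_eq c_def power_divide)
  then obtain k where "c = of_nat k"
    using prime_subfield_eq by (auto simp: prime_subfield_def)
  then have "abs_trace p m (of_nat k * z) = c * abs_trace p m z"
    by (simp add: trace_of_nat_mult)
  then have "abs_trace p m (of_nat k * z) = j"
    using z by (simp add: c_def)
  then show ?thesis ..
qed

text \<open>By surjectivity each fibre is a translate of the kernel; \<open>p\<close> fibres of
  equal size partition \<open>p ^ m\<close> elements.\<close>

lemma card_trace_fibre:
  assumes "j \<in> prime_subfield p"
  shows "card {y::'b. abs_trace p m y = j} = p ^ (m - 1)"
proof -
  have fibre: "card {y::'b. abs_trace p m y = i} = card {y::'b. abs_trace p m y = 0}"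
    if "i \<in> prime_subfield p" for i
  proof -
    obtain z :: 'b where z: "abs_trace p m z = i"
      using \<open>i \<in> prime_subfield p\<close> trace_surj by blast
    have "{y. abs_trace p m y = i} = (+) z ` {y. abs_trace p m y = 0}"
    proof (intro equalityI subsetI)
      fix y assume "y \<in> {y. abs_trace p m y = i}"
      then have "abs_trace p m (y - z) = 0"
        using trace_add[of z "y - z"] z by simp
      then show "y \<in> (+) z ` {y. abs_trace p m y = 0}"
        by (intro image_eqI[of _ _ "y - z"]) auto
    qed (auto simp: trace_add z)
    then show ?thesis
      by (simp add: card_image)
  qed
  have "p ^ m = (\<Sum>y\<in>(UNIV::'b set). 1)"
    by (simp add: card_field)
  also have "\<dots> = (\<Sum>i\<in>prime_subfield p. card {y::'b. abs_trace p m y = i})"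
    using sum_fun_comp[of UNIV "prime_subfield p" "abs_trace p m :: 'b \<Rightarrow> 'b" "\<lambda>_. 1::nat"]
    by (simp add: image_subset_iff trace_in_prime_subfield)
  also have "\<dots> = p * card {y::'b. abs_trace p m y = j}"
    using fibre fibre[OF assms] by (simp add: card_prime_subfield)
  finally have "p * p ^ (m - 1) = p * card {y::'b. abs_trace p m y = j}"
    using m_gt_0 by (metis Suc_diff_1 power_Suc)
  then show ?thesis
    using p_gt_0 by simp
qed

section \<open>Additive characters and their sums\<close>

lemma zeta_pow_of_nat: "zeta_pow p (of_nat k :: 'b) = zeta p ^ k"
proof -
  \<comment> \<open>The chosen representative is the reduced residue; replacing it by
    \<open>k\<close> is harmless because \<open>zeta p ^ p = 1\<close>.\<close>
  have "residue_rep p (of_nat k :: 'b) = k mod p"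
    unfolding residue_rep_def
    by (rule the_equality) (use p_gt_0 in \<open>auto simp: of_nat_eq_iff_mod\<close>)
  then show ?thesis
    by (simp add: zeta_pow_def zeta_power_mod[OF p_gt_0])
qed

lemma zeta_pow_add:
  fixes a b :: 'b
  assumes "a \<in> prime_subfield p" "b \<in> prime_subfield p"
  shows "zeta_pow p (a + b) = zeta_pow p a * zeta_pow p b"
  using assms zeta_pow_of_nat
  by (auto simp: prime_subfield_def power_add simp flip: of_nat_add)

lemma sum_zeta_pow_eq_0: "(\<Sum>a\<in>(prime_subfield p :: 'b set). zeta_pow p a) = 0"
proof -
  have "(\<Sum>a\<in>(prime_subfield p :: 'b set). zeta_pow p a) = (\<Sum>k<p. zeta p ^ k)"
    unfolding prime_subfield_def by (simp add: sum.reindex inj_on_of_nat zeta_pow_of_nat)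
  also have "\<dots> = 0"
    using geometric_sum[OF zeta_neq_1[OF p_gt_1], of p] zeta_power_eq_1[OF p_gt_0] by simp
  finally show ?thesis .
qed

text \<open>Grouping by the value of \<open>h\<close> leaves \<open>c\<close> times the vanishing
  sum of all \<open>p\<close>-th roots of unity.\<close>

lemma sum_zeta_pow_equal_fibres:
  fixes h :: "'c::finite \<Rightarrow> 'b"
  assumes "range h \<subseteq> prime_subfield p"
    and "\<And>j. j \<in> prime_subfield p \<Longrightarrow> card {x. h x = j} = c"
  shows "(\<Sum>x\<in>UNIV. zeta_pow p (h x)) = 0"
proof -
  have "(\<Sum>x\<in>UNIV. zeta_pow p (h x))
      = (\<Sum>j\<in>prime_subfield p. of_nat (card {x. h x = j}) * zeta_pow p j)"
    using sum_fun_comp[of UNIV "prime_subfield p" h "zeta_pow p"] assms(1) by simp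
  also have "\<dots> = of_nat c * (\<Sum>j\<in>(prime_subfield p :: 'b set). zeta_pow p j)"
    by (simp add: assms(2) sum_distrib_left)
  finally show ?thesis
    by (simp add: sum_zeta_pow_eq_0)
qed

lemma card_trace_mult_fibre:
  fixes z :: 'b
  assumes "j \<in> prime_subfield p" "z \<noteq> 0"
  shows "card {w. abs_trace p m (z * w) = j} = p ^ (m - 1)"
proof -
  have "bij_betw ((*) z) {w. abs_trace p m (z * w) = j} {y. abs_trace p m y = j}"
    by (rule bij_betw_byWitness[where f' = "\<lambda>y. y / z"]) (use assms(2) in auto)
  then show ?thesis
    using card_trace_fibre[OF assms(1)] by (simp add: bij_betw_same_card)
qed

text \<open>Orthogonality of characters, the kernel of the Fourier inversion: for nonzero
  \<open>z\<close> the trace of \<open>w * z\<close> takes every value equally often as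
  \<open>w\<close> varies.\<close>

lemma character_sum:
  "(\<Sum>w\<in>UNIV. zeta_pow p (abs_trace p m (w * z :: 'b))) = (if z = 0 then of_nat (p ^ m) else 0)"
proof (cases "z = 0")
  case True
  then show ?thesis
    using zeta_pow_of_nat[of 0] p_gt_0
    by (simp add: abs_trace_def power_0_left card_field)
next
  case False
  then show ?thesis
    using sum_zeta_pow_equal_fibres[of "\<lambda>w. abs_trace p m (z * w)" "p ^ (m - 1)"]
    by (simp add: image_subset_iff trace_in_prime_subfield card_trace_mult_fibre mult.commute[of _ z])
qed

section \<open>The three implications\<close>

lemma AC_eq_0_if_level_counts_0:
  fixes F :: "'a::{field,finite} \<Rightarrow> 'b"
  assumes "\<And>j. j \<in> prime_subfield p \<Longrightarrow> level_count p n m F u v j = 0"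
  shows "AC p m F u v = 0"
  unfolding AC_def
proof (rule sum_zeta_pow_equal_fibres[where c = "p ^ (n - 1)"])
  fix j :: 'b assume "j \<in> prime_subfield p"
  then have "int (card {x. abs_trace p m (v * derivative F u x) = j}) = int (p ^ (n - 1))"
    using assms by (simp add: level_count_def)
  then show "card {x. abs_trace p m (v * derivative F u x) = j} = p ^ (n - 1)"
    by (simp only: of_nat_eq_iff)
qed (auto simp: trace_in_prime_subfield)

text \<open>There are \<open>p ^ (m - 1)\<close> values \<open>y\<close> for which
  \<open>v * y\<close> has trace \<open>j\<close>, and each has p^(n-m) preimages under the
  derivative.\<close>

lemma level_count_eq_0_if_balanced:
  fixes F :: "'a::{field,finite} \<Rightarrow> 'b"
  assumes "balanced p n m (derivative F u)" "n \<ge> 1" "v \<noteq> 0" "j \<in> prime_subfield p"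
  shows "level_count p n m F u v j = 0"
proof -
  let ?G = "derivative F u"
  have "real (card {x. abs_trace p m (v * ?G x) = j})
      = (\<Sum>x\<in>UNIV. if abs_trace p m (v * ?G x) = j then 1 else 0)"
    by (simp add: sum.If_cases)
  also have "\<dots> = (\<Sum>y\<in>UNIV. real (card {x. ?G x = y}) * (if abs_trace p m (v * y) = j then 1 else 0))"
    using sum_fun_comp[of UNIV UNIV ?G "\<lambda>y. if abs_trace p m (v * y) = j then 1 else (0::real)"]
    by simp
  also have "\<dots> = real p powi (int n - int m) * real (card {y. abs_trace p m (v * y) = j})"
    using assms(1) by (simp add: balanced_def sum.If_cases if_distrib cong: if_cong)
  \<comment> \<open>Exponents become integers, as \<open>n - m\<close> may be negative; the
    truncated subtractions \<open>m - 1\<close> and, below, \<open>n - 1\<close> are exact since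
    both numbers are positive.\<close>
  also have "\<dots> = real p powi (int n - int m) * real p powi (int m - 1)"
    using m_gt_0 assms by (simp add: card_trace_mult_fibre power_int_def nat_diff_distrib)
  also have "\<dots> = real p powi (int n - 1)"
    using p_gt_0 by (simp flip: power_int_add)
  also have "\<dots> = real (p ^ (n - 1))"
    using assms(2) by (simp add: power_int_def nat_diff_distrib)
  finally have "card {x. abs_trace p m (v * ?G x) = j} = p ^ (n - 1)"
    by (simp only: of_nat_eq_iff)
  then show ?thesis
    by (simp add: level_count_def)
qed

lemma balanced_if_AC_eq_0:
  fixes F :: "'a::{field,finite} \<Rightarrow> 'b"
  assumes "\<And>w. w \<noteq> 0 \<Longrightarrow> AC p m F u w = 0" "CARD('a) = p ^ n"
  shows "balanced p n m (derivative F u)"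
  unfolding balanced_def
proof
  fix y :: 'b
  let ?G = "derivative F u"
  let ?\<chi> = "\<lambda>z::'b. zeta_pow p (abs_trace p m z)"
  have chi_add: "?\<chi> (a + b) = ?\<chi> a * ?\<chi> b" for a b
    by (simp add: trace_add zeta_pow_add trace_in_prime_subfield)
  have chi_0: "?\<chi> 0 = 1"
    using zeta_pow_of_nat[of 0] p_gt_0 by (simp add: abs_trace_def power_0_left)
  have "of_nat (p ^ m * card {x. ?G x = y}) = (\<Sum>x\<in>UNIV. if ?G x - y = 0 then of_nat (p ^ m) else (0::complex))"
    by (simp add: sum.If_cases)
  also have "\<dots> = (\<Sum>x\<in>UNIV. \<Sum>w\<in>UNIV. ?\<chi> (w * (?G x - y)))"
    by (simp only: character_sum)
  also have "\<dots> = (\<Sum>w\<in>UNIV. \<Sum>x\<in>UNIV. ?\<chi> (w * (?G x - y)))"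
    by (rule sum.swap)
  \<comment> \<open>The character splits into a factor at \<open>w * ?G x\<close> and one at
    \<open>- (w * y)\<close>; the latter is independent of \<open>x\<close> and leaves the inner
    sum.\<close>
  also have "\<dots> = (\<Sum>w\<in>UNIV. ?\<chi> (- (w * y)) * AC p m F u w)"
    by (simp add: AC_def sum_distrib_left algebra_simps flip: chi_add)
  also have "\<dots> = (\<Sum>w\<in>{0}. ?\<chi> (- (w * y)) * AC p m F u w)"
    by (rule sum.mono_neutral_right) (auto simp: assms(1))
  \<comment> \<open>At \<open>w = 0\<close> every summand of \<open>AC\<close> is 1, so the sum
    counts the domain.\<close>
  also have "\<dots> = of_nat (p ^ n)"
    using chi_0 by (simp add: AC_def assms(2))
  finally have "p ^ m * card {x. ?G x = y} = p ^ n"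
    by (simp only: of_nat_eq_iff)
  then have "real p ^ m * real (card {x. ?G x = y}) = real p ^ n"
    by (metis of_nat_mult of_nat_power)
  then show "real (card {x. ?G x = y}) = real p powi (int n - int m)"
    using p_gt_0 by (simp add: power_int_diff field_simps)
qed

end

theorem corollary4p5:
  fixes p n m :: nat
    and F :: "'a::{field,finite} \<Rightarrow> 'b::{field,finite}"
    and u :: 'a
  assumes "prime p" and "n \<ge> 1" and "m \<ge> 1"
    and "CARD('a) = p ^ n" and "CARD('b) = p ^ m"
  shows "(balanced p n m (derivative F u) \<longleftrightarrow>
            (\<forall>v::'b. v \<noteq> 0 \<longrightarrow> (\<forall>j\<in>prime_subfield p. level_count p n m F u v j = 0)))
       \<and> ((\<forall>v::'b. v \<noteq> 0 \<longrightarrow> (\<forall>j\<in>prime_subfield p. level_count p n m F u v j = 0)) \<longleftrightarrow>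
            (\<forall>w::'b. w \<noteq> 0 \<longrightarrow> AC p m F u w = 0))"
proof -
  interpret finite_field_of_order p m "TYPE('b)"
    using assms by unfold_locales
  \<comment> \<open>The implications (i) to (ii), (ii) to (iii) and (iii) to (i) form a cycle, which
    yields both equivalences.\<close>
  show ?thesis
    using level_count_eq_0_if_balanced[of n F u] AC_eq_0_if_level_counts_0[of n F u]
      balanced_if_AC_eq_0[of F u n] assms by blast
qed

end
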